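(* Let $(S,\mathcal{A},\mu)$ be a custody scheme with $|S|=n$ and $|\mathcal{A}|=m$, let $\beta\in(0,1)$ with $\beta m$ a positive integer, and let $\mathcal{A}'$ be a uniformly random subfamily of $\mathcal{A}$ consisting of $\beta m$ groups. Let $\gamma\in(0,1)$ with $\gamma n\in\mathbb{N}$ and $n\gamma(1-\gamma)\ge 1$. Let $\eta$ and $\eta'$ be the efficiency factors against a $\gamma$-adversary of the custody schemes $(S,\mathcal{A},\mu)$ and $(S,\mathcal{A}',\mu)$ respectively. Then for every $c\ge 0$, with probability at least $1-\frac{e}{2\pi}\exp(-c\,nH(\gamma))$ over the choice of $\mathcal{A}'$, $$\eta' \;\ge\; \frac{\gamma(\eta+1)\sqrt{\beta m}}{\gamma\sqrt{\beta m}+(\eta+1)\sqrt{(1+c)\,nH(\gamma)/2}}-1 ,$$ where, if $\eta=+\infty$, the right-hand side is read as its limit as $\eta\to\infty$.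
   Context: A custody scheme $(S,\mathcal{A},\mu)$ consists of a set $S$ of $n$ nodes, a family $\mathcal{A}$ of $m$ $k$-subsets of $S$ (called groups; repetitions are counted with multiplicity), and a threshold $\mu\in[1/2,1)$. For $\gamma\in(0,1)$ with $\gamma n\in\mathbb{N}$ let $$f(\gamma;S,\mathcal{A},\mu):=\max_{B\subseteq S,\ |B|=\gamma n}\big|\{A\in\mathcal{A} : |A\cap B|>\mu k\}\big| .$$ The efficiency factor against a $\gamma$-adversary is $\eta:=\dfrac{\gamma |\mathcal{A}|}{f(\gamma;S,\mathcal{A},\mu)}-1$, with $\eta=+\infty$ if $f=0$. Moreover $H(\gamma):=-\big(\gamma\ln\gamma+(1-\gamma)\ln(1-\gamma)\big)$. *)

theory Defs
  imports "HOL-Probability.Probability"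
begin

text \<open>
  A family of groups with repetitions is an indexed family \<open>A\<close> over a finite index set \<open>I\<close>:
  its size is \<open>card I\<close>, groups are counted with multiplicity by counting indices, and a
  subfamily is the restriction of \<open>A\<close> to some \<open>J \<subseteq> I\<close>.
\<close>

definition custody_scheme ::
  "'a set \<Rightarrow> 'i set \<Rightarrow> ('i \<Rightarrow> 'a set) \<Rightarrow> nat \<Rightarrow> real \<Rightarrow> bool" where
  "custody_scheme S I A k \<mu> \<longleftrightarrow>
     finite S \<and> finite I \<and> (\<forall>i\<in>I. A i \<subseteq> S \<and> card (A i) = k) \<and> 1 / 2 \<le> \<mu> \<and> \<mu> < 1"

definition max_corrupted ::
  "real \<Rightarrow> 'a set \<Rightarrow> 'i set \<Rightarrow> ('i \<Rightarrow> 'a set) \<Rightarrow> nat \<Rightarrow> real \<Rightarrow> nat" where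
  "max_corrupted \<gamma> S I A k \<mu> =
     Max ((\<lambda>B. card {i \<in> I. real (card (A i \<inter> B)) > \<mu> * real k}) `
            {B. B \<subseteq> S \<and> real (card B) = \<gamma> * real (card S)})"

definition efficiency_factor ::
  "real \<Rightarrow> 'a set \<Rightarrow> 'i set \<Rightarrow> ('i \<Rightarrow> 'a set) \<Rightarrow> nat \<Rightarrow> real \<Rightarrow> ereal" where
  "efficiency_factor \<gamma> S I A k \<mu> =
     (if max_corrupted \<gamma> S I A k \<mu> = 0 then \<infinity>
      else ereal (\<gamma> * real (card I) / real (max_corrupted \<gamma> S I A k \<mu>) - 1))"

definition entropy_nat :: "real \<Rightarrow> real" where
  "entropy_nat \<gamma> = - (\<gamma> * ln \<gamma> + (1 - \<gamma>) * ln (1 - \<gamma>))"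

definition subfamily_bound :: "real \<Rightarrow> real \<Rightarrow> real \<Rightarrow> nat \<Rightarrow> nat \<Rightarrow> real \<Rightarrow> real" where
  "subfamily_bound \<gamma> \<beta> c n m x =
     \<gamma> * (x + 1) * sqrt (\<beta> * real m) /
     (\<gamma> * sqrt (\<beta> * real m) + (x + 1) * sqrt ((1 + c) * (real n * entropy_nat \<gamma>) / 2)) - 1"

definition at_or_limit :: "(real \<Rightarrow> real) \<Rightarrow> ereal \<Rightarrow> real" where
  "at_or_limit g y = (if y = \<infinity> then Lim at_top g else g (real_of_ereal y))"

end

theory Submission
  imports Defs
begin

text \<open>
  For a fixed corrupted set \<open>B\<close> the number of captured groups in the random subfamily is
  hypergeometric, and it exceeds its mean by \<open>t \<beta> m\<close> with probability at most
  \<open>exp (- 2 \<beta> m t\<^sup>2)\<close> by Hoeffding's inequality for sampling without replacement. The claim is the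
  union bound over the \<open>n choose \<gamma> n\<close> sets \<open>B\<close>, with \<open>2 \<beta> m t\<^sup>2 = (1 + c) n H(\<gamma>)\<close>. The constant
  \<open>e / (2 \<pi>)\<close> comes from \<open>sqrt (2 \<pi> n) (n / e)\<^sup>n \<le> n! \<le> e sqrt n (n / e)\<^sup>n\<close>, which gives
  \<open>n choose \<gamma> n \<le> e / (2 \<pi>) exp (n H(\<gamma>)) / sqrt (n \<gamma> (1 - \<gamma>))\<close>.
\<close>


section \<open>Stirling bounds with explicit constants and the binomial coefficient\<close>

text \<open>The logarithm of \<open>n! / (sqrt n (n / e)^n)\<close> for positive \<open>n\<close>.
  The constant of Stirling's formula is kept inside, so the limit is \<open>ln (2 * pi) / 2\<close>
  and not 0.\<close>

definition stirling_err :: "nat \<Rightarrow> real" where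
  "stirling_err n = ln (fact n) - (real n + 1 / 2) * ln (real n) + real n"

lemma stirling_err_diff:
  assumes "n > 0"
  shows "stirling_err n - stirling_err (Suc n) =
           (real n + 1 / 2) * (ln (real n + 1) - ln (real n)) - 1"
proof -
  have "ln (fact (Suc n) :: real) = ln (real n + 1) + ln (fact n)"
    using ln_mult[of "real n + 1" "fact n"] by (simp add: algebra_simps)
  then show ?thesis by (simp add: stirling_err_def field_simps del: fact_Suc)
qed

text \<open>By convexity of \<open>1 / x\<close>, its integral over \<open>[n, n + 1]\<close> is at
  least the midpoint value \<open>1 / (n + 1 / 2)\<close>.\<close>

lemma stirling_err_Suc_le:
  assumes "n > 0"
  shows "stirling_err (Suc n) \<le> stirling_err n"
proof -
  have "2 / (2 * real n + 1) \<le> ln (real n + 1) - ln (real n)"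
    using ln_inverse_approx_ge[of "real n" "real n + 1"] assms by simp
  then have "1 \<le> (real n + 1 / 2) * (ln (real n + 1) - ln (real n))"
    using assms by (simp add: field_simps)
  then show ?thesis using stirling_err_diff[OF assms] by simp
qed

text \<open>The trapezoid rule overestimates the integral of the convex function
  \<open>1 / x\<close>, so one step loses at most \<open>1 / (4 n (n + 1))\<close>, which
  telescopes.\<close>

lemma stirling_err_Suc_ge:
  assumes "n > 0"
  shows "stirling_err n - 1 / (4 * real n) \<le> stirling_err (Suc n) - 1 / (4 * real (Suc n))"
proof -
  have "ln (real n + 1) - ln (real n) \<le> (inverse (real n) + inverse (real n + 1)) / 2"
    using ln_inverse_approx_le[of "real n" 1] assms by simp
  then have "(real n + 1 / 2) * (ln (real n + 1) - ln (real n)) \<le>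
               (real n + 1 / 2) * ((inverse (real n) + inverse (real n + 1)) / 2)"
    by (intro mult_left_mono) auto
  also have "\<dots> = 1 + 1 / (4 * real n) - 1 / (4 * real (Suc n))"
    using assms by (simp add: divide_simps) (simp add: algebra_simps)
  finally show ?thesis using stirling_err_diff[OF assms] by simp
qed

text \<open>Expresses the partial Wallis products through \<open>n!\<close> and
  \<open>(2 n)!\<close>, the factorials that occur in the Stirling errors of \<open>n\<close> and
  \<open>2 n\<close>.\<close>

lemma wallis_prod_eq:
  "(\<Prod>k=1..n. (4 * real k ^ 2) / (4 * real k ^ 2 - 1)) =
     16 ^ n * fact n ^ 4 / (fact (2 * n) ^ 2 * (2 * real n + 1))"
proof (induction n)
  case (Suc n)
  have f2: "(fact (2 * Suc n) :: real) = 2 * (real n + 1) * (2 * real n + 1) * fact (2 * n)"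
    by (simp add: algebra_simps)
  have f1: "(fact (Suc n) :: real) = (real n + 1) * fact n"
    by (simp add: algebra_simps)
  have d: "4 * real (Suc n) ^ 2 - 1 = (2 * real n + 1) * (2 * real n + 3)"
    by (simp add: algebra_simps power2_eq_square)
  have p: "2 * real n + 1 \<noteq> 0" "2 * real n + 3 \<noteq> 0" "real n + 1 \<noteq> 0" by linarith+
  have "(\<Prod>k=1..Suc n. (4 * real k ^ 2) / (4 * real k ^ 2 - 1)) =
          16 ^ n * fact n ^ 4 / (fact (2 * n) ^ 2 * (2 * real n + 1)) *
          ((4 * (real n + 1) ^ 2) / ((2 * real n + 1) * (2 * real n + 3)))"
    using Suc d by (simp add: add.commute)
  also have "\<dots> = 16 ^ Suc n * fact (Suc n) ^ 4 / (fact (2 * Suc n) ^ 2 * (2 * real (Suc n) + 1))"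
    unfolding f1 f2 using p
    by (simp add: divide_simps) (simp add: algebra_simps power2_eq_square power4_eq_xxxx)
  finally show ?case .
qed simp

text \<open>In the exponent all terms growing faster than \<open>ln n\<close> cancel, leaving
  Wallis' product.\<close>
lemma exp_stirling_err_wallis:
  assumes "n > 0"
  shows "exp (2 * (2 * stirling_err n - stirling_err (2 * n))) =
           (\<Prod>k=1..n. (4 * real k ^ 2) / (4 * real k ^ 2 - 1)) * (4 + 2 / real n)"
proof -
  have "2 * (2 * stirling_err n - stirling_err (2 * n)) =
          4 * ln (fact n) - 2 * ln (fact (2 * n)) + real (4 * n + 1) * ln 2 - ln (real n)"
    using assms by (simp add: stirling_err_def ln_mult algebra_simps)
  also have "\<dots> = ln (fact n ^ 4 * 2 ^ (4 * n + 1) / (fact (2 * n) ^ 2 * real n))"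
    using assms by (simp add: ln_mult ln_div ln_realpow del: power_Suc power_add)
  finally have "exp (2 * (2 * stirling_err n - stirling_err (2 * n))) =
                  fact n ^ 4 * 2 ^ (4 * n + 1) / (fact (2 * n) ^ 2 * real n)"
    using assms by simp
  also have "\<dots> = 16 ^ n * fact n ^ 4 / (fact (2 * n) ^ 2 * (2 * real n + 1)) * (4 + 2 / real n)"
  proof -
    have "(2::real) ^ (4 * n + 1) = 2 * 16 ^ n" by (simp add: power_mult)
    moreover have "2 * real n + 1 \<noteq> 0" by linarith
    ultimately show ?thesis using assms by (simp add: divide_simps)
  qed
  finally show ?thesis by (simp only: wallis_prod_eq)
qed

text \<open>The value at 1 is exactly 1 and the sequence decreases from there.\<close>

lemma stirling_err_le_1:
  assumes "n > 0"
  shows "stirling_err n \<le> 1"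
  using assms
proof (induction n rule: nat_induct_non_zero)
  case (Suc n)
  then show ?case using stirling_err_Suc_le[of n] by linarith
qed (simp add: stirling_err_def)

text \<open>The sequence decreases, and subtracting \<open>1 / (4 n)\<close> makes it increase, so
  it is bounded below by the corrected value \<open>3 / 4\<close> at 1.\<close>

lemma stirling_err_convergent:
  obtains L where "stirling_err \<longlonglongrightarrow> L" "\<And>n. n > 0 \<Longrightarrow> L \<le> stirling_err n"
proof -
  \<comment> \<open>The shift is there because both monotonicity lemmas require a positive
    index.\<close>
  let ?d = "\<lambda>n. stirling_err (Suc n)"
  let ?e = "\<lambda>n. ?d n - 1 / (4 * real (Suc n))"
  have dec: "decseq ?d" by (intro decseq_SucI stirling_err_Suc_le) simp
  have inc: "incseq ?e" by (intro incseq_SucI stirling_err_Suc_ge) simp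
  have lower: "\<forall>n. 3 / 4 \<le> ?d n"
  proof
    fix n
    have "3 / 4 \<le> ?e n" using incseqD[OF inc, of 0 n] by (simp add: stirling_err_def)
    also have "?e n \<le> ?d n" by simp
    finally show "3 / 4 \<le> ?d n" .
  qed
  obtain L where L: "?d \<longlonglongrightarrow> L" "\<forall>n. L \<le> ?d n"
    by (rule decseq_convergent[OF dec lower])
  show thesis
  proof (rule that)
    show "stirling_err \<longlonglongrightarrow> L" using L(1) by (rule LIMSEQ_imp_Suc)
    show "L \<le> stirling_err n" if "n > 0" for n
      using L(2)[rule_format, of "n - 1"] that by simp
  qed
qed

text \<open>A decreasing sequence stays above its limit \<open>L\<close>. Along \<open>n\<close> and
  \<open>2 n\<close> the combination \<open>2 s(n) - s(2 n)\<close> of Stirling errors also tends to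
  \<open>L\<close>, and Wallis' product gives \<open>exp (2 * L) = 2 * pi\<close>.\<close>

lemma stirling_err_ge:
  assumes "n > 0"
  shows "ln (2 * pi) / 2 \<le> stirling_err n"
proof -
  obtain L where sL: "stirling_err \<longlonglongrightarrow> L" and L: "\<And>n. n > 0 \<Longrightarrow> L \<le> stirling_err n"
    using stirling_err_convergent by blast
  have "(\<lambda>n. stirling_err (2 * n)) \<longlonglongrightarrow> L"
    using LIMSEQ_subseq_LIMSEQ[OF sL, of "\<lambda>n. 2 * n"] by (simp add: o_def strict_mono_def)
  then have "(\<lambda>n. exp (2 * (2 * stirling_err n - stirling_err (2 * n)))) \<longlonglongrightarrow> exp (2 * (2 * L - L))"
    using sL by (intro tendsto_intros)
  moreover have "(\<lambda>n. exp (2 * (2 * stirling_err n - stirling_err (2 * n)))) \<longlonglongrightarrow> pi / 2 * (4 + 0)"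
  proof (rule Lim_transform_eventually)
    show "(\<lambda>n. (\<Prod>k=1..n. (4 * real k ^ 2) / (4 * real k ^ 2 - 1)) * (4 + 2 / real n)) \<longlonglongrightarrow>
            pi / 2 * (4 + 0)"
      by (intro tendsto_intros wallis lim_const_over_n)
    show "eventually (\<lambda>n. (\<Prod>k=1..n. (4 * real k ^ 2) / (4 * real k ^ 2 - 1)) * (4 + 2 / real n)
        = exp (2 * (2 * stirling_err n - stirling_err (2 * n)))) sequentially"
      by (rule eventually_mono[OF eventually_gt_at_top[of 0]])
         (rule exp_stirling_err_wallis[symmetric])
  qed
  ultimately have "exp (2 * (2 * L - L)) = pi / 2 * (4 + 0)" by (rule LIMSEQ_unique)
  then have "exp (2 * L) = 2 * pi" by simp
  then have "ln (exp (2 * L)) = ln (2 * pi)" by (rule arg_cong)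
  then show ?thesis using L[OF assms] by simp
qed

lemma binomial_le_exp_entropy:
  fixes \<gamma> :: real
  assumes "0 < \<gamma>" "\<gamma> < 1" and r: "real r = \<gamma> * real n" and n: "n > 0"
  shows "real (n choose r) \<le> exp 1 / (2 * pi) *
           exp (- real n * (\<gamma> * ln \<gamma> + (1 - \<gamma>) * ln (1 - \<gamma>))) / sqrt (real n * \<gamma> * (1 - \<gamma>))"
proof -
  have "real r < real n" "real r > 0" using assms by auto
  then have rn: "r < n" "0 < r" by auto
  have s: "real (n - r) = (1 - \<gamma>) * real n" using rn r by (simp add: of_nat_diff algebra_simps)
  have lr: "ln (real r) = ln \<gamma> + ln (real n)" unfolding r using assms by (simp add: ln_mult)
  have ls: "ln (real (n - r)) = ln (1 - \<gamma>) + ln (real n)" unfolding s using assms by (simp add: ln_mult)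
  have lf: "ln (fact N) = stirling_err N + (real N + 1 / 2) * ln (real N) - real N" for N
    by (simp add: stirling_err_def)
  have "ln (real (n choose r)) = ln (fact n) - ln (fact r) - ln (fact (n - r))"
    using rn by (simp add: binomial_fact ln_div ln_mult)
  also have "\<dots> = stirling_err n - stirling_err r - stirling_err (n - r)
      - real n * (\<gamma> * ln \<gamma> + (1 - \<gamma>) * ln (1 - \<gamma>)) - (ln (real n) + ln \<gamma> + ln (1 - \<gamma>)) / 2"
    unfolding lf lr ls unfolding r s by (simp add: field_simps)
  \<comment> \<open>One upper bound for \<open>n\<close> and two lower bounds for \<open>r\<close>
    and \<open>n - r\<close>: after exponentiation, a factor \<open>e\<close> and twice
    \<open>1 / sqrt (2 * pi)\<close>.\<close>
  also have "\<dots> \<le> 1 - ln (2 * pi) / 2 - ln (2 * pi) / 2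
      - real n * (\<gamma> * ln \<gamma> + (1 - \<gamma>) * ln (1 - \<gamma>)) - (ln (real n) + ln \<gamma> + ln (1 - \<gamma>)) / 2"
    using rn by (intro diff_right_mono diff_mono stirling_err_le_1 stirling_err_ge) auto
  also have "\<dots> = 1 - ln (2 * pi) + - real n * (\<gamma> * ln \<gamma> + (1 - \<gamma>) * ln (1 - \<gamma>)) -
      ln (sqrt (real n * \<gamma> * (1 - \<gamma>)))"
    using assms by (simp add: ln_sqrt ln_mult)
  finally have "ln (real (n choose r)) \<le> \<dots>" .
  then have "real (n choose r) \<le> exp (1 - ln (2 * pi) + - real n * (\<gamma> * ln \<gamma> + (1 - \<gamma>) * ln (1 - \<gamma>)) -
      ln (sqrt (real n * \<gamma> * (1 - \<gamma>))))"
    using rn by (metis exp_le_cancel_iff exp_ln of_nat_0_less_iff less_imp_le zero_less_binomial)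
  also have "\<dots> = exp (1 - ln (2 * pi)) * exp (- real n * (\<gamma> * ln \<gamma> + (1 - \<gamma>) * ln (1 - \<gamma>))) /
      sqrt (real n * \<gamma> * (1 - \<gamma>))"
    unfolding exp_diff[of _ "ln (sqrt _)"] exp_add using assms n by simp
  also have "exp (1 - ln (2 * pi)) = exp 1 / (2 * pi)" by (simp add: exp_diff)
  finally show ?thesis .
qed

section \<open>Hoeffding's inequality for sampling without replacement\<close>

lemma power_card_eq_sum_Pow:
  fixes x :: real
  assumes "finite X"
  shows "(1 + x) ^ card X = (\<Sum>T\<in>Pow X. x ^ card T)"
  using prod_add[OF assms, of "\<lambda>_. x" "\<lambda>_. 1"] by (simp add: add.commute)

text \<open>Such a \<open>J\<close> is determined by \<open>J - T\<close>, an arbitrary subset of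
  \<open>I - T\<close> of size \<open>M - card T\<close>. The case \<open>card T > M\<close> is
  separate because truncated subtraction would turn the binomial into 1.\<close>

lemma card_supersets_of_card:
  assumes "finite I" "T \<subseteq> I"
  shows "card {J. J \<subseteq> I \<and> card J = M \<and> T \<subseteq> J} =
           (if card T \<le> M then (card I - card T) choose (M - card T) else 0)"
proof (cases "card T \<le> M")
  case True
  have fT: "finite T" using assms finite_subset by blast
  have "bij_betw (\<lambda>J. J - T) {J. J \<subseteq> I \<and> card J = M \<and> T \<subseteq> J}
          {J. J \<subseteq> I - T \<and> card J = M - card T}"
  proof (rule bij_betwI[where g = "\<lambda>J. J \<union> T"])
    show "(\<lambda>J. J \<union> T) \<in> {J. J \<subseteq> I - T \<and> card J = M - card T} \<rightarrow>
            {J. J \<subseteq> I \<and> card J = M \<and> T \<subseteq> J}"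
    proof
      fix J assume J: "J \<in> {J. J \<subseteq> I - T \<and> card J = M - card T}"
      then have "finite J" "J \<inter> T = {}" using assms finite_subset by blast+
      then have "card (J \<union> T) = card J + card T" using fT by (simp add: card_Un_disjoint)
      then show "J \<union> T \<in> {J. J \<subseteq> I \<and> card J = M \<and> T \<subseteq> J}" using J assms True by auto
    qed
  qed (use fT in \<open>auto simp: card_Diff_subset\<close>)
  then have "card {J. J \<subseteq> I \<and> card J = M \<and> T \<subseteq> J} = card {J. J \<subseteq> I - T \<and> card J = M - card T}"
    by (rule bij_betw_same_card)
  also have "\<dots> = card (I - T) choose (M - card T)"
    using assms by (intro n_subsets) auto
  finally show ?thesis using True assms fT by (simp add: card_Diff_subset)
next
  case False
  have "{J. J \<subseteq> I \<and> card J = M \<and> T \<subseteq> J} = {}"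
    using False assms by (auto dest: card_mono[rotated] finite_subset)
  then show ?thesis using False by (simp only: card.empty if_False)
qed

text \<open>The quotient of the two binomials is a product of factors
  \<open>(K - i) / (m - i)\<close>, each at most \<open>K / m\<close>; the form without division
  stays in the naturals.\<close>

lemma binomial_mult_power_le:
  fixes K m j :: nat
  assumes "K \<le> m"
  shows "(K choose j) * m ^ j \<le> (m choose j) * K ^ j"
proof (induction j)
  case (Suc j)
  have step: "Suc j * (N choose Suc j) = (N - j) * (N choose j)" for N
    using times_binomial_minus1_eq[of "Suc j" N] by (simp only: binomial_absorb_comp diff_Suc_1 zero_less_Suc)
  have cross: "(K - j) * m \<le> (m - j) * K"
    using assms by (simp add: diff_mult_distrib mult.commute[of K m] diff_le_mono2)
  have "Suc j * ((K choose Suc j) * m ^ Suc j) = (Suc j * (K choose Suc j)) * (m ^ j * m)"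
    by (simp only: mult.assoc power_Suc2)
  also have "\<dots> = ((K choose j) * m ^ j) * ((K - j) * m)"
    by (simp only: step mult_ac)
  also have "\<dots> \<le> ((m choose j) * K ^ j) * ((m - j) * K)"
    by (intro mult_le_mono Suc cross)
  also have "\<dots> = (Suc j * (m choose Suc j)) * (K ^ j * K)"
    by (simp only: step mult_ac)
  also have "\<dots> = Suc j * ((m choose Suc j) * K ^ Suc j)"
    by (simp only: mult.assoc power_Suc2)
  finally show ?case by (simp only: nat_mult_le_cancel1 zero_less_Suc)
qed auto

text \<open>The left-hand side is \<open>m choose M\<close> times the probability generating function of a
  hypergeometric variable at \<open>1 + x\<close>; it is dominated by that of the binomial variable with the
  same mean because the factorial moments are.\<close>
lemma sum_power_card_Int_le:
  fixes x :: real
  assumes "finite I" "G \<subseteq> I" "M \<le> card I" "0 \<le> x"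
  shows "(\<Sum>J | J \<subseteq> I \<and> card J = M. (1 + x) ^ card (J \<inter> G)) \<le>
           real (card I choose M) * (1 + x * (real (card G) / real (card I))) ^ M"
proof -
  let ?m = "card I" and ?K = "card G"
  let ?F = "{J. J \<subseteq> I \<and> card J = M}"
  \<comment> \<open>The number of \<open>M\<close>-subsets of \<open>I\<close> that contain a given
    \<open>j\<close>-subset.\<close>
  define h where "h j = (if j \<le> M then (?m - j) choose (M - j) else 0)" for j
  have fG: "finite G" using assms finite_subset by blast
  have fF: "finite ?F" using assms by simp
  have Km: "?K \<le> ?m" using assms by (simp add: card_mono)
  \<comment> \<open>Expand each power over the subsets of \<open>J \<inter> G\<close>, so that after
    swapping the sums only supersets of a fixed \<open>T\<close> are counted.\<close>
  have "(\<Sum>J\<in>?F. (1 + x) ^ card (J \<inter> G)) = (\<Sum>J\<in>?F. \<Sum>T | T \<in> Pow G \<and> T \<subseteq> J. x ^ card T)"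
    using fG by (intro sum.cong refl, subst power_card_eq_sum_Pow) (auto intro!: sum.cong)
  also have "\<dots> = (\<Sum>T\<in>Pow G. \<Sum>J | J \<in> ?F \<and> T \<subseteq> J. x ^ card T)"
    using fG fF by (intro sum.swap_restrict) auto
  also have "\<dots> = (\<Sum>T\<in>Pow G. real (h (card T)) * x ^ card T)"
  proof (rule sum.cong[OF refl])
    fix T assume "T \<in> Pow G"
    then have "T \<subseteq> I" using assms by auto
    from card_supersets_of_card[OF assms(1) this, of M]
    show "(\<Sum>J | J \<in> ?F \<and> T \<subseteq> J. x ^ card T) = real (h (card T)) * x ^ card T"
      by (simp add: h_def conj_assoc)
  qed
  also have "\<dots> = (\<Sum>j\<le>?m. \<Sum>T | T \<in> Pow G \<and> card T = j. real (h (card T)) * x ^ card T)"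
    using fG Km by (intro sum.group[symmetric]) (auto intro: card_mono order_trans)
  also have "\<dots> = (\<Sum>j\<le>?m. real (?K choose j) * (real (h j) * x ^ j))"
  proof (rule sum.cong[OF refl])
    fix j
    have "(\<Sum>T | T \<in> Pow G \<and> card T = j. real (h (card T)) * x ^ card T) =
            (\<Sum>T | T \<subseteq> G \<and> card T = j. real (h j) * x ^ j)"
      by (intro sum.cong) auto
    then show "(\<Sum>T | T \<in> Pow G \<and> card T = j. real (h (card T)) * x ^ card T) =
                 real (?K choose j) * (real (h j) * x ^ j)"
      using fG by (simp add: n_subsets)
  qed
  also have "\<dots> \<le> (\<Sum>j\<le>?m. real (?m choose M) * (real (M choose j) * (x * (real ?K / real ?m)) ^ j))"
  proof (rule sum_mono)
    fix j assume j: "j \<in> {..?m}"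
    show "real (?K choose j) * (real (h j) * x ^ j) \<le>
            real (?m choose M) * (real (M choose j) * (x * (real ?K / real ?m)) ^ j)"
    proof (cases "j \<le> M")
      case True
      have "real (?K choose j) * real (?m ^ j) \<le> real (?m choose j) * real (?K ^ j)"
        using binomial_mult_power_le[OF Km, of j] by (metis of_nat_le_iff of_nat_mult)
      \<comment> \<open>For \<open>?m = 0\<close> the quotient \<open>?K / ?m\<close> is 0 by
        convention, and the inequality survives because its power is then
        \<open>0 ^ 0 = 1\<close>.\<close>
      moreover have "?m = 0 \<Longrightarrow> j = 0" using j by simp
      ultimately have 1: "real (?K choose j) \<le> real (?m choose j) * (real ?K / real ?m) ^ j"
        by (cases "?m = 0") (simp_all add: field_simps)
      \<comment> \<open>Both sides count pairs of a \<open>j\<close>-set inside an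
        \<open>M\<close>-set.\<close>
      have "(?m choose M) * (M choose j) = (?m choose j) * h j"
        using choose_mult[OF True assms(3)] True by (simp add: h_def)
      then have 2: "real (?m choose M) * real (M choose j) = real (?m choose j) * real (h j)"
        by (simp only: of_nat_mult[symmetric])
      have "real (?K choose j) * (real (h j) * x ^ j) \<le>
              (real (?m choose j) * (real ?K / real ?m) ^ j) * (real (h j) * x ^ j)"
        using 1 assms by (intro mult_right_mono) auto
      also have "\<dots> = (real (?m choose j) * real (h j)) * (x * (real ?K / real ?m)) ^ j"
        by (simp only: power_mult_distrib mult_ac)
      finally show ?thesis unfolding 2[symmetric] by simp
    qed (use assms(4) in \<open>simp add: h_def\<close>)
  qed
  also have "\<dots> = real (?m choose M) * (\<Sum>j\<le>?m. real (M choose j) * (x * (real ?K / real ?m)) ^ j)"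
    by (simp add: sum_distrib_left)
  also have "(\<Sum>j\<le>?m. real (M choose j) * (x * (real ?K / real ?m)) ^ j) =
               (\<Sum>j\<le>M. real (M choose j) * (x * (real ?K / real ?m)) ^ j)"
    using assms(3) by (intro sum.mono_neutral_right) auto
  also have "\<dots> = (1 + x * (real ?K / real ?m)) ^ M"
    using binomial_ring[of "x * (real ?K / real ?m)" 1 M] by (simp add: add.commute)
  finally show ?thesis .
qed

text \<open>Chernoff's method: exponential Markov inequality, domination by the binomial generating
  function at \<open>exp l\<close>, then Hoeffding's lemma for a Bernoulli variable.\<close>

theorem Hoeffding_sample_without_replacement:
  fixes t :: real
  assumes "finite I" "G \<subseteq> I" "M \<le> card I" "0 \<le> t"
  shows "measure_pmf.prob (pmf_of_set {J. J \<subseteq> I \<and> card J = M})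
           {J. real (card (J \<inter> G)) \<ge> real M * (real (card G) / real (card I) + t)}
         \<le> exp (- 2 * real M * t\<^sup>2)"
proof -
  let ?F = "{J. J \<subseteq> I \<and> card J = M}"
  define p where "p = real (card G) / real (card I)"
  define E where "E = {J. real (card (J \<inter> G)) \<ge> real M * (p + t)}"
  \<comment> \<open>This minimises the final exponent \<open>M (l^2 / 8 - l t)\<close>, with value
    \<open>-2 M t^2\<close>.\<close>
  define l where "l = 4 * t"
  define N where "N = real (card I choose M)"
  have fF: "finite ?F" using assms by simp
  have cF: "real (card ?F) = N" unfolding N_def using assms by (simp add: n_subsets)
  have Npos: "N > 0" unfolding N_def using assms by simp
  have neF: "?F \<noteq> {}" using cF Npos by fastforce
  have l: "l \<ge> 0" using assms by (simp add: l_def)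
  have p: "p \<ge> 0" by (simp add: p_def)
  have pos: "1 + p * (exp l - 1) > 0" using p l by (intro add_pos_nonneg mult_nonneg_nonneg) auto
  have "exp (l * (real M * (p + t))) * real (card (?F \<inter> E)) =
          (\<Sum>J\<in>?F \<inter> E. exp (l * (real M * (p + t))))" by simp
  also have "\<dots> \<le> (\<Sum>J\<in>?F \<inter> E. exp (l * real (card (J \<inter> G))))"
    using l by (intro sum_mono) (auto simp: E_def intro!: mult_left_mono)
  also have "\<dots> \<le> (\<Sum>J\<in>?F. exp (l * real (card (J \<inter> G))))"
    using fF by (intro sum_mono2) auto
  also have "\<dots> = (\<Sum>J\<in>?F. (1 + (exp l - 1)) ^ card (J \<inter> G))"
    by (simp add: exp_of_nat_mult[symmetric] mult.commute)
  also have "\<dots> \<le> N * (1 + (exp l - 1) * p) ^ M"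
    unfolding N_def p_def using assms l by (intro sum_power_card_Int_le) auto
  also have "\<dots> \<le> N * exp (l * p + l\<^sup>2 / 8) ^ M"
  proof -
    have "ln (1 + p * (exp l - 1)) \<le> l * p + l\<^sup>2 / 8"
      using Hoeffdings_lemma_aux[OF l p] by simp
    then have "1 + p * (exp l - 1) \<le> exp (l * p + l\<^sup>2 / 8)"
      using pos by (metis exp_le_cancel_iff exp_ln)
    then show ?thesis using pos Npos by (intro mult_left_mono power_mono) (auto simp: mult.commute)
  qed
  also have "\<dots> = N * exp (real M * (l * p + l\<^sup>2 / 8))" by (simp add: exp_of_nat_mult)
  finally have "real (card (?F \<inter> E)) / N \<le>
      exp (real M * (l * p + l\<^sup>2 / 8)) / exp (l * (real M * (p + t)))"
    using Npos by (simp add: field_simps)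
  also have "\<dots> = exp (- 2 * real M * t\<^sup>2)"
    unfolding exp_diff[symmetric] l_def by (simp add: field_simps power2_eq_square)
  finally show ?thesis
    unfolding E_def p_def using fF neF cF by (simp add: measure_pmf_of_set)
qed

section \<open>Efficiency factors of subfamilies and the union bound\<close>

text \<open>Puts the dependence on \<open>J\<close> into an intersection with a set fixed before
  sampling, the form that the tail bound handles.\<close>

lemma max_corrupted_subset_eq:
  assumes "J \<subseteq> I" and "\<gamma> * real (card S) = real r"
  shows "max_corrupted \<gamma> S J A k \<mu> =
           Max ((\<lambda>B. card (J \<inter> {i \<in> I. real (card (A i \<inter> B)) > \<mu> * real k})) `
                  {B. B \<subseteq> S \<and> card B = r})"
proof -
  have "{i \<in> J. real (card (A i \<inter> B)) > \<mu> * real k} =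
          J \<inter> {i \<in> I. real (card (A i \<inter> B)) > \<mu> * real k}" for B
    using assms(1) by auto
  then show ?thesis unfolding max_corrupted_def assms(2) by simp
qed

lemma entropy_nat_nonneg:
  assumes "0 < \<gamma>" "\<gamma> < 1"
  shows "0 \<le> entropy_nat \<gamma>"
  using assms mult_nonneg_nonpos[of \<gamma> "ln \<gamma>"] mult_nonneg_nonpos[of "1 - \<gamma>" "ln (1 - \<gamma>)"]
  by (simp add: entropy_nat_def)

text \<open>With \<open>x + 1 = \<gamma> m / f\<close> the bound plus 1 simplifies to
  \<open>\<gamma> / (f / m + w / sqrt M)\<close>, which is \<open>\<gamma> M\<close> divided by the
  assumed upper bound on \<open>f'\<close>.\<close>

lemma subfamily_bound_le:
  fixes f f' m M n :: nat
  assumes "0 < \<gamma>" "0 < f" "0 < f'" "0 < m" "0 < M" and M: "\<beta> * real m = real M"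
    and w: "w = sqrt ((1 + c) * (real n * entropy_nat \<gamma>) / 2)" "0 \<le> w"
    and f': "real f' \<le> real M * (real f / real m + w / sqrt (real M))"
  shows "subfamily_bound \<gamma> \<beta> c n m (\<gamma> * real m / real f - 1) \<le> \<gamma> * real M / real f' - 1"
proof -
  define s where "s = sqrt (real M)"
  have s: "s > 0" using assms by (simp add: s_def)
  have den: "real f * s + real m * w > 0" using s assms by (intro add_pos_nonneg) auto
  have "subfamily_bound \<gamma> \<beta> c n m (\<gamma> * real m / real f - 1) =
          \<gamma> * (\<gamma> * real m / real f) * s / (\<gamma> * s + (\<gamma> * real m / real f) * w) - 1"
    by (simp add: subfamily_bound_def M s_def w(1))
  also have "\<gamma> * s + (\<gamma> * real m / real f) * w = (\<gamma> / real f) * (real f * s + real m * w)"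
    using assms by (simp add: field_simps)
  also have "\<gamma> * (\<gamma> * real m / real f) * s / ((\<gamma> / real f) * (real f * s + real m * w)) =
               \<gamma> * (real m * s) / (real f * s + real m * w)"
    using assms den by simp
  also have "\<gamma> * (real m * s) / (real f * s + real m * w) \<le> \<gamma> * real M / real f'"
  proof -
    have "real f' * (real m * s) \<le> real M * (real f / real m + w / s) * (real m * s)"
      using f' s unfolding s_def by (intro mult_right_mono) auto
    also have "\<dots> = real M * (real f * s + real m * w)"
      using s assms by (simp add: field_simps)
    finally have "real m * s / (real f * s + real m * w) \<le> real M / real f'"
      using den assms by (simp add: divide_le_eq pos_le_divide_eq field_simps)
    then have "\<gamma> * (real m * s / (real f * s + real m * w)) \<le> \<gamma> * (real M / real f')"
      using assms by (intro mult_left_mono) auto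
    then show ?thesis by simp
  qed
  finally show ?thesis by simp
qed

text \<open>\<open>B\<close> is a maximiser for \<open>J\<close>; for the full family it is merely
  one competitor, hence only an inequality there.\<close>

lemma max_corrupted_attained:
  fixes A :: "'i \<Rightarrow> 'a set" and k :: nat and \<mu> :: real
  assumes "finite S" "finite I" "J \<subseteq> I" and r: "\<gamma> * real (card S) = real r" "r \<le> card S"
  defines "G \<equiv> \<lambda>B. {i \<in> I. real (card (A i \<inter> B)) > \<mu> * real k}"
  obtains B where "B \<subseteq> S" "card B = r" "max_corrupted \<gamma> S J A k \<mu> = card (J \<inter> G B)"
    "card (G B) \<le> max_corrupted \<gamma> S I A k \<mu>"
proof -
  define Bs where "Bs = {B. B \<subseteq> S \<and> card B = r}"
  have eq: "max_corrupted \<gamma> S K A k \<mu> = Max ((\<lambda>B. card (K \<inter> G B)) ` Bs)" if "K \<subseteq> I" for K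
    unfolding Bs_def G_def using that r(1) by (rule max_corrupted_subset_eq)
  have fBs: "finite Bs" using assms(1) by (simp add: Bs_def)
  obtain B0 where "B0 \<subseteq> S" "card B0 = r" using r(2) obtain_subset_with_card_n by metis
  then have neBs: "Bs \<noteq> {}" by (auto simp: Bs_def)
  have "max_corrupted \<gamma> S J A k \<mu> \<in> (\<lambda>B. card (J \<inter> G B)) ` Bs"
    unfolding eq[OF assms(3)] using fBs neBs by (intro Max_in) auto
  then obtain B where B: "B \<in> Bs" "max_corrupted \<gamma> S J A k \<mu> = card (J \<inter> G B)" by blast
  have "card (I \<inter> G B) \<le> max_corrupted \<gamma> S I A k \<mu>"
    unfolding eq[OF subset_refl] using fBs B(1) by (intro Max_ge) auto
  moreover have "I \<inter> G B = G B" by (auto simp: G_def)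
  ultimately have "card (G B) \<le> max_corrupted \<gamma> S I A k \<mu>" by simp
  with that B show thesis by (auto simp: Bs_def)
qed

text \<open>The deterministic half of the argument: if no \<open>B\<close> captures too many sampled
  groups, apply this to the worst \<open>B\<close> for \<open>J\<close>.\<close>

lemma efficiency_factor_subfamily_ge:
  fixes m M n :: nat
  assumes "finite S" "finite I" "J \<subseteq> I" and card: "card I = m" "card J = M" "0 < m" "0 < M"
    and r: "\<gamma> * real (card S) = real r" "r \<le> card S"
    and \<gamma>: "0 < \<gamma>" and M: "\<beta> * real m = real M"
    and w: "w = sqrt ((1 + c) * (real n * entropy_nat \<gamma>) / 2)" "0 \<le> w"
    and few: "\<And>B. B \<subseteq> S \<Longrightarrow> card B = r \<Longrightarrow>
      real (card (J \<inter> {i \<in> I. real (card (A i \<inter> B)) > \<mu> * real k})) <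
        real M * (real (card {i \<in> I. real (card (A i \<inter> B)) > \<mu> * real k}) / real m + w / sqrt (real M))"
  shows "ereal (at_or_limit (subfamily_bound \<gamma> \<beta> c n m) (efficiency_factor \<gamma> S I A k \<mu>))
           \<le> efficiency_factor \<gamma> S J A k \<mu>"
proof -
  define f where "f K = max_corrupted \<gamma> S K A k \<mu>" for K
  obtain B where B: "B \<subseteq> S" "card B = r"
      "f J = card (J \<inter> {i \<in> I. real (card (A i \<inter> B)) > \<mu> * real k})"
      "card {i \<in> I. real (card (A i \<inter> B)) > \<mu> * real k} \<le> f I"
    unfolding f_def by (rule max_corrupted_attained[OF assms(1-3) r])
  show ?thesis
  proof (cases "f J = 0")
    case False
    \<comment> \<open>Hence an infinite efficiency factor of the full family forces
      \<open>f J = 0\<close>, the other case, where the factor of \<open>J\<close> is infinite as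
      well.\<close>
    have "f J \<le> f I"
      unfolding B(3) using assms(2) by (intro order_trans[OF card_mono B(4)]) auto
    then have fI: "f I \<noteq> 0" using False by simp
    have "real (f J) \<le> real M * (real (card {i \<in> I. real (card (A i \<inter> B)) > \<mu> * real k}) / real m
        + w / sqrt (real M))"
      using few[OF B(1,2)] B(3) by simp
    also have "\<dots> \<le> real M * (real (f I) / real m + w / sqrt (real M))"
      using B(4) by (intro mult_left_mono add_right_mono divide_right_mono) auto
    finally have "subfamily_bound \<gamma> \<beta> c n m (\<gamma> * real m / real (f I) - 1) \<le> \<gamma> * real M / real (f J) - 1"
      by (intro subfamily_bound_le[OF \<gamma> _ _ card(3,4) M w]) (use False fI in simp_all)
    then show ?thesis
      using False fI card by (simp add: efficiency_factor_def at_or_limit_def f_def)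
  qed (simp add: efficiency_factor_def f_def)
qed

lemma prob_efficiency_factor_less_le:
  assumes fin: "finite S" "finite I" and card: "card S = n" "card I = m" "0 < m"
    and M: "\<beta> * real m = real M" "0 < M" "M \<le> m"
    and r: "\<gamma> * real n = real r" and \<gamma>: "0 < \<gamma>" "\<gamma> < 1" and "real n * \<gamma> * (1 - \<gamma>) \<ge> 1" and "c \<ge> 0"
  shows "measure_pmf.prob (pmf_of_set {J. J \<subseteq> I \<and> card J = M})
           {J. efficiency_factor \<gamma> S J A k \<mu> <
               ereal (at_or_limit (subfamily_bound \<gamma> \<beta> c n m) (efficiency_factor \<gamma> S I A k \<mu>))}
         \<le> exp 1 / (2 * pi) * exp (- c * real n * entropy_nat \<gamma>)"
proof -
  define F where "F = {J. J \<subseteq> I \<and> card J = M}"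
  define Bs where "Bs = {B. B \<subseteq> S \<and> card B = r}"
  define G where "G B = {i \<in> I. real (card (A i \<inter> B)) > \<mu> * real k}" for B
  define bad where "bad = {J. efficiency_factor \<gamma> S J A k \<mu> <
    ereal (at_or_limit (subfamily_bound \<gamma> \<beta> c n m) (efficiency_factor \<gamma> S I A k \<mu>))}"
  define P where "P X = real (card (F \<inter> X)) / real (card F)" for X
  define H where "H = entropy_nat \<gamma>"
  define w where "w = sqrt ((1 + c) * (real n * H) / 2)"
  define t where "t = w / sqrt (real M)"
  define E where "E B = {J. real (card (J \<inter> G B)) \<ge> real M * (real (card (G B)) / real m + t)}" for B
  have GI: "G B \<subseteq> I" for B by (auto simp: G_def)
  have fBs: "finite Bs" using fin by (simp add: Bs_def)
  have cBs: "card Bs = n choose r" using fin card by (simp add: Bs_def n_subsets)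
  have n0: "0 < n" using assms(12) by (cases n) auto
  have "real r \<le> real n" unfolding r[symmetric] using \<gamma> by (simp add: mult_left_le_one_le)
  then have rn: "r \<le> n" by simp
  have fF: "finite F" using fin by (simp add: F_def)
  have cF: "card F = m choose M" using fin card by (simp add: F_def n_subsets)
  have neF: "F \<noteq> {}"
  proof
    assume "F = {}"
    then have "m choose M = 0" using cF by simp
    then show False using M by simp
  qed
  have P: "measure_pmf.prob (pmf_of_set F) X = P X" for X
    using neF fF by (simp add: measure_pmf_of_set P_def)
  have H0: "0 \<le> H" unfolding H_def using \<gamma> by (rule entropy_nat_nonneg)
  have w0: "0 \<le> w" unfolding w_def using H0 assms(13) by simp
  have t0: "0 \<le> t" unfolding t_def using w0 by simp
  have t2: "2 * real M * t\<^sup>2 = (1 + c) * (real n * H)"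
    using H0 assms(13) M by (simp add: t_def w_def power_divide)
  \<comment> \<open>The contrapositive of \<open>efficiency_factor_subfamily_ge\<close>: a sample
    outside every \<open>E B\<close> meets the bound.\<close>
  have bad: "F \<inter> bad \<subseteq> (\<Union>B\<in>Bs. F \<inter> E B)"
  proof
    fix J assume J: "J \<in> F \<inter> bad"
    then have JI: "J \<subseteq> I" "card J = M" by (auto simp: F_def)
    show "J \<in> (\<Union>B\<in>Bs. F \<inter> E B)"
    proof (rule ccontr)
      assume notin: "J \<notin> (\<Union>B\<in>Bs. F \<inter> E B)"
      have "ereal (at_or_limit (subfamily_bound \<gamma> \<beta> c n m) (efficiency_factor \<gamma> S I A k \<mu>))
              \<le> efficiency_factor \<gamma> S J A k \<mu>"
      proof (rule efficiency_factor_subfamily_ge[OF fin JI(1) card(2) JI(2) card(3) M(2) _ _ \<gamma>(1) M(1)])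
        show "\<gamma> * real (card S) = real r" "r \<le> card S" using r rn card by auto
        show "w = sqrt ((1 + c) * (real n * entropy_nat \<gamma>) / 2)" by (simp add: w_def H_def)
        fix B assume "B \<subseteq> S" "card B = r"
        then have "J \<notin> E B" using notin J by (auto simp: Bs_def)
        then show "real (card (J \<inter> {i \<in> I. real (card (A i \<inter> B)) > \<mu> * real k})) <
            real M * (real (card {i \<in> I. real (card (A i \<inter> B)) > \<mu> * real k}) / real m + w / sqrt (real M))"
          by (simp add: E_def G_def t_def not_le)
      qed (rule w0)
      then show False using J by (auto simp: bad_def)
    qed
  qed
  have "real (card (F \<inter> bad)) \<le> (\<Sum>B\<in>Bs. real (card (F \<inter> E B)))"
  proof -
    have "card (F \<inter> bad) \<le> card (\<Union>B\<in>Bs. F \<inter> E B)"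
      using bad fF fBs by (intro card_mono) auto
    also have "\<dots> \<le> (\<Sum>B\<in>Bs. card (F \<inter> E B))" by (rule card_UN_le[OF fBs])
    finally show ?thesis unfolding of_nat_sum[symmetric] of_nat_le_iff .
  qed
  then have "P bad \<le> (\<Sum>B\<in>Bs. P (E B))"
    unfolding P_def sum_divide_distrib[symmetric] by (rule divide_right_mono) simp
  also have "\<dots> \<le> (\<Sum>B\<in>Bs. exp (- 2 * real M * t\<^sup>2))"
  proof (rule sum_mono)
    fix B
    show "P (E B) \<le> exp (- 2 * real M * t\<^sup>2)"
      using Hoeffding_sample_without_replacement[OF fin(2) GI[of B], of M t] M(3) t0
      unfolding card(2) F_def[symmetric] E_def[symmetric] P by simp
  qed
  also have "\<dots> = real (n choose r) * exp (- ((1 + c) * (real n * H)))"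
    using t2 by (simp add: cBs)
  also have "\<dots> \<le> (exp 1 / (2 * pi) * exp (real n * H)) * exp (- ((1 + c) * (real n * H)))"
  proof (rule mult_right_mono)
    have "real (n choose r) \<le> exp 1 / (2 * pi) * exp (real n * H) / sqrt (real n * \<gamma> * (1 - \<gamma>))"
      using binomial_le_exp_entropy[OF \<gamma> r[symmetric] n0]
      by (simp only: H_def entropy_nat_def mult_minus_left mult_minus_right)
    \<comment> \<open>The hypothesis \<open>n \<gamma> (1 - \<gamma>) \<ge> 1\<close> makes the
      square root at least 1.\<close>
    also have "\<dots> \<le> exp 1 / (2 * pi) * exp (real n * H)"
      using assms(12) by (simp add: divide_le_eq mult_le_cancel_left1)
    finally show "real (n choose r) \<le> exp 1 / (2 * pi) * exp (real n * H)" .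
  qed simp
  \<comment> \<open>Of the \<open>(1 + c) n H\<close> in the tail exponent, one \<open>n H\<close>
    pays for the number of sets \<open>B\<close>.\<close>
  also have "\<dots> = exp 1 / (2 * pi) * exp (- c * real n * H)"
    unfolding mult.assoc exp_add[symmetric] by (simp add: algebra_simps)
  finally show ?thesis unfolding P[symmetric] F_def bad_def H_def .
qed

theorem theorem3:
  fixes S :: "'a set" and I :: "'i set" and A :: "'i \<Rightarrow> 'a set"
    and n m k :: nat and \<mu> \<beta> \<gamma> c :: real
  assumes "custody_scheme S I A k \<mu>"
    and "card S = n" and "card I = m"
    and "0 < \<beta>" and "\<beta> < 1" and "\<beta> * real m \<in> \<nat>" and "0 < \<beta> * real m"
    and "0 < \<gamma>" and "\<gamma> < 1" and "\<gamma> * real n \<in> \<nat>"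
    and "real n * \<gamma> * (1 - \<gamma>) \<ge> 1"
    and "c \<ge> 0"
  shows "measure_pmf.prob (pmf_of_set {J. J \<subseteq> I \<and> real (card J) = \<beta> * real m})
           {J. efficiency_factor \<gamma> S J A k \<mu> \<ge>
               ereal (at_or_limit (subfamily_bound \<gamma> \<beta> c n m) (efficiency_factor \<gamma> S I A k \<mu>))}
         \<ge> 1 - exp 1 / (2 * pi) * exp (- c * real n * entropy_nat \<gamma>)"
proof -
  obtain M where M: "\<beta> * real m = real M" using assms(6) by (auto elim: Nats_cases)
  obtain r where r: "\<gamma> * real n = real r" using assms(10) by (auto elim: Nats_cases)
  have fin: "finite S" "finite I" using assms(1) by (auto simp: custody_scheme_def)
  have M0: "0 < M" using M assms(7) by simp
  have m0: "0 < m" using assms(7) by (cases m) auto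
  have "real M \<le> real m"
    unfolding M[symmetric] using assms(4,5) by (simp add: mult_left_le_one_le)
  then have Mm: "M \<le> m" by simp
  let ?bad = "{J. efficiency_factor \<gamma> S J A k \<mu> <
      ereal (at_or_limit (subfamily_bound \<gamma> \<beta> c n m) (efficiency_factor \<gamma> S I A k \<mu>))}"
  have "measure_pmf.prob (pmf_of_set {J. J \<subseteq> I \<and> card J = M}) ?bad
      \<le> exp 1 / (2 * pi) * exp (- c * real n * entropy_nat \<gamma>)"
    by (rule prob_efficiency_factor_less_le[OF fin assms(2,3) m0 M M0 Mm r assms(8,9,11,12)])
  moreover have "measure_pmf.prob p (- ?bad) = 1 - measure_pmf.prob p ?bad" for p
    using measure_pmf.prob_compl[of ?bad p] by (simp add: Compl_eq_Diff_UNIV)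
  moreover have "- ?bad = {J. efficiency_factor \<gamma> S J A k \<mu> \<ge>
      ereal (at_or_limit (subfamily_bound \<gamma> \<beta> c n m) (efficiency_factor \<gamma> S I A k \<mu>))}"
    by (auto simp: not_less)
  ultimately show ?thesis unfolding M of_nat_eq_iff by simp
qed

end
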